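(* Consider the storage-concerned economic dispatch problem OP and its relaxation RP (obtained by dropping the complementarity constraints), as defined in the context, and assume OP has a unique global optimal solution $\Omega_0^*$, with optimal value $v_0^*$. Assume that for every $i\in\mathcal N$ the charging price is less than the discharging price: $f_i'(x)<g_i'(y)$ for all $x\in[0,\overline P_i^c]$ and $y\in[0,\overline P_i^d]$. Let $\Omega_1^*=(p_i^c(t),p_i^d(t),p_i^g(t))_{i\in\mathcal N,t\in\mathcal T}$ be an optimal solution of RP, with optimal value $v_1^*$ and corresponding stored energies $s_i(t)$, together with a dual solution (multipliers satisfying the KKT conditions of RP with $\Omega_1^*$), and let $LMP_i(t)$ be the associated local marginal prices. Suppose that for every $i\in\mathcal N$ and $t\in\mathcal T$ at which the inequality $$LMP_i(t)>\frac{f_i'(p_i^c(t))-\eta_i^c\eta_i^d\,g_i'(p_i^d(t))}{1-\eta_i^c\eta_i^d}$$ fails, one has $s_i(\tau)<\overline S_i$ for all $\tau\in\mathcal T$ with $\tau\ge t$. Then $v_1^*=v_0^*$ and $\Omega_1^*=\Omega_0^*$.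
   Context: Setting: $\mathcal N$ is a finite set of buses, $\mathcal L$ a finite set of branches, $\mathcal T=\{1,\dots,T\}$ the set of time slots, $\Delta t>0$ the step length. The decision variables are $\Omega=(p_i^c(t),p_i^d(t),p_i^g(t))_{i\in\mathcal N,t\in\mathcal T}$ (real charging power, discharging power, generator output). The objective to be minimized is $$v(\Omega)=\sum_{t\in\mathcal T}\sum_{i\in\mathcal N}\big(g_i(p_i^d(t))-f_i(p_i^c(t))+h_i(p_i^g(t))\big),$$ where $g_i,h_i$ are convex quadratic functions and $f_i$ is a linear function; primes denote derivatives. Real data: bounds $\overline P_i^c,\overline P_i^d,\underline P_i^g,\overline P_i^g,\underline S_i,\overline S_i,R_i^d,R_i^u,\underline P_j^l,\overline P_j^l$; demands $D_i(t)$; coefficients $GSF_{j-i}$ for $j\in\mathcal L$, $i\in\mathcal N$; initial energies $s_i^0$; self-discharge rates $\varepsilon_i\in[0,1)$; charging and discharging efficiencies $\eta_i^c,\eta_i^d\in(0,1]$ with $\eta_i^c\eta_i^d<1$. The stored energy is $$s_i(t)=(1-\varepsilon_i)^t s_i^0+\sum_{\tau=1}^t(1-\varepsilon_i)^{t-\tau}\big(\eta_i^c p_i^c(\tau)-p_i^d(\tau)/\eta_i^d\big)\Delta t.$$ Constraints (for all $i\in\mathcal N$, $j\in\mathcal L$, $t\in\mathcal T$, the ramp constraint being for $t=1,\dots,T-1$), with multipliers where named: (a) $0\le p_i^c(t)\le\overline P_i^c$, multipliers $\alpha_{i,1}(t)$ (lower), $\alpha_{i,2}(t)$ (upper); (b)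 $0\le p_i^d(t)\le\overline P_i^d$, multipliers $\alpha_{i,3}(t)$ (lower), $\alpha_{i,4}(t)$ (upper); (c) $p_i^d(t)p_i^c(t)=0$ (complementarity); (d) $\underline P_i^g\le p_i^g(t)\le\overline P_i^g$; (e) $\underline S_i\le s_i(t)\le\overline S_i$, multipliers $\beta_{i,1}(t)$ (lower), $\beta_{i,2}(t)$ (upper); (f) $R_i^d\Delta t\le p_i^g(t+1)-p_i^g(t)\le R_i^u\Delta t$; (g) $\sum_{i\in\mathcal N}(p_i^g(t)+p_i^d(t)-p_i^c(t))=\sum_{i\in\mathcal N}D_i(t)$, multiplier $\lambda(t)$; (h) $\underline P_j^l\le\sum_{i\in\mathcal N}GSF_{j-i}\,(p_i^g(t)+p_i^d(t)-p_i^c(t)-D_i(t))\le\overline P_j^l$, multipliers $\mu_{j,1}(t)$ (lower), $\mu_{j,2}(t)$ (upper). OP: minimize $v(\Omega)$ subject to (a)-(h). RP: minimize $v(\Omega)$ subject to (a),(b),(d)-(h), i.e. without (c). Multiplier conventions for RP: multipliers of inequality constraints are nonnegative and satisfy complementary slackness; in the Lagrangian, a lower bound $\underline x\le x$ with multiplier $\mu$ contributes $\mu(\underline x-x)$, an upper bound $x\le\overline x$ with multiplier $\mu$ contributes $\mu(x-\overline x)$, and the balance equation (g) contributes $\lambda(t)\big(\sum_i D_i(t)-\sum_i(p_i^g(t)+p_i^d(t)-p_i^c(t))\big)$. The local marginal price is $$LMP_i(t)=\lambda(t)+\sum_{j\in\mathcal L}GSF_{j-i}\,(\mu_{j,1}(t)-\mu_{j,2}(t)).$$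 *)

theory Defs
  imports "HOL-Analysis.Analysis"
begin

text \<open>Data of a storage-concerned economic dispatch problem, with buses of type \<^typ>\<open>'n\<close> and
  branches of type \<^typ>\<open>'l\<close>. The time slots are \<open>1, \<dots>, horizon\<close>.\<close>

record ('n, 'l) dispatch =
  buses :: "'n set"
  branches :: "'l set"
  horizon :: nat
  time_step :: real
  charge_ub :: "'n \<Rightarrow> real"
  discharge_ub :: "'n \<Rightarrow> real"
  gen_lb :: "'n \<Rightarrow> real"
  gen_ub :: "'n \<Rightarrow> real"
  energy_lb :: "'n \<Rightarrow> real"
  energy_ub :: "'n \<Rightarrow> real"
  ramp_down :: "'n \<Rightarrow> real"
  ramp_up :: "'n \<Rightarrow> real"
  line_lb :: "'l \<Rightarrow> real"
  line_ub :: "'l \<Rightarrow> real"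
  demand :: "'n \<Rightarrow> nat \<Rightarrow> real"
  GSF :: "'l \<Rightarrow> 'n \<Rightarrow> real"
  init_energy :: "'n \<Rightarrow> real"
  self_discharge :: "'n \<Rightarrow> real"
  charge_eff :: "'n \<Rightarrow> real"
  discharge_eff :: "'n \<Rightarrow> real"
  discharge_cost :: "'n \<Rightarrow> real \<Rightarrow> real" \<comment> \<open>\<open>g\<^sub>i\<close>\<close>
  charge_benefit :: "'n \<Rightarrow> real \<Rightarrow> real" \<comment> \<open>\<open>f\<^sub>i\<close>\<close>
  gen_cost :: "'n \<Rightarrow> real \<Rightarrow> real" \<comment> \<open>\<open>h\<^sub>i\<close>\<close>

definition slots :: "('n, 'l) dispatch \<Rightarrow> nat set" where
  "slots D = {1..horizon D}"

text \<open>A constant term is allowed in linear functions, and the leading coefficient of a convex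
  quadratic function may vanish.\<close>

definition linear_fun :: "(real \<Rightarrow> real) \<Rightarrow> bool" where
  "linear_fun f \<longleftrightarrow> (\<exists>b c. \<forall>x. f x = b * x + c)"

definition convex_quadratic :: "(real \<Rightarrow> real) \<Rightarrow> bool" where
  "convex_quadratic g \<longleftrightarrow>
     (\<exists>a b c. \<forall>x. g x = a * x\<^sup>2 + b * x + c) \<and> convex_on UNIV g"

definition valid_dispatch :: "('n, 'l) dispatch \<Rightarrow> bool" where
  "valid_dispatch D \<longleftrightarrow>
     finite (buses D) \<and> finite (branches D) \<and> time_step D > 0 \<and>
     (\<forall>i\<in>buses D.
        0 \<le> self_discharge D i \<and> self_discharge D i < 1 \<and>
        0 < charge_eff D i \<and> charge_eff D i \<le> 1 \<and>
        0 < discharge_eff D i \<and> discharge_eff D i \<le> 1 \<and>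
        charge_eff D i * discharge_eff D i < 1 \<and>
        convex_quadratic (discharge_cost D i) \<and>
        linear_fun (charge_benefit D i) \<and>
        convex_quadratic (gen_cost D i))"

text \<open>The decision variables. Each component is a family indexed by buses and time slots, encoded as
  an extensional function, so that equality of plans is equality of these families.\<close>

record 'n plan =
  p_c :: "'n \<times> nat \<Rightarrow> real"
  p_d :: "'n \<times> nat \<Rightarrow> real"
  p_g :: "'n \<times> nat \<Rightarrow> real"

definition plans :: "('n, 'l) dispatch \<Rightarrow> 'n plan set" where
  "plans D = {\<Omega>. p_c \<Omega> \<in> extensional (buses D \<times> slots D) \<and>
                  p_d \<Omega> \<in> extensional (buses D \<times> slots D) \<and>
                  p_g \<Omega> \<in> extensional (buses D \<times> slots D)}"

definition objective :: "('n, 'l) dispatch \<Rightarrow> 'n plan \<Rightarrow> real" where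
  "objective D \<Omega> = (\<Sum>t\<in>slots D. \<Sum>i\<in>buses D.
     discharge_cost D i (p_d \<Omega> (i, t)) - charge_benefit D i (p_c \<Omega> (i, t))
       + gen_cost D i (p_g \<Omega> (i, t)))"

definition energy :: "('n, 'l) dispatch \<Rightarrow> 'n plan \<Rightarrow> 'n \<Rightarrow> nat \<Rightarrow> real" where
  "energy D \<Omega> i t = (1 - self_discharge D i) ^ t * init_energy D i +
     (\<Sum>\<tau>=1..t. (1 - self_discharge D i) ^ (t - \<tau>) *
        (charge_eff D i * p_c \<Omega> (i, \<tau>) - p_d \<Omega> (i, \<tau>) / discharge_eff D i) * time_step D)"

definition flow :: "('n, 'l) dispatch \<Rightarrow> 'n plan \<Rightarrow> 'l \<Rightarrow> nat \<Rightarrow> real" where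
  "flow D \<Omega> j t = (\<Sum>i\<in>buses D.
     GSF D j i * (p_g \<Omega> (i, t) + p_d \<Omega> (i, t) - p_c \<Omega> (i, t) - demand D i t))"

definition RP_feasible :: "('n, 'l) dispatch \<Rightarrow> 'n plan \<Rightarrow> bool" where
  "RP_feasible D \<Omega> \<longleftrightarrow> \<Omega> \<in> plans D \<and>
     (\<forall>i\<in>buses D. \<forall>t\<in>slots D. 0 \<le> p_c \<Omega> (i, t) \<and> p_c \<Omega> (i, t) \<le> charge_ub D i) \<and>
     (\<forall>i\<in>buses D. \<forall>t\<in>slots D. 0 \<le> p_d \<Omega> (i, t) \<and> p_d \<Omega> (i, t) \<le> discharge_ub D i) \<and>
     (\<forall>i\<in>buses D. \<forall>t\<in>slots D. gen_lb D i \<le> p_g \<Omega> (i, t) \<and> p_g \<Omega> (i, t) \<le> gen_ub D i) \<and>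
     (\<forall>i\<in>buses D. \<forall>t\<in>slots D. energy_lb D i \<le> energy D \<Omega> i t \<and> energy D \<Omega> i t \<le> energy_ub D i) \<and>
     (\<forall>i\<in>buses D. \<forall>t\<in>{1..<horizon D}.
        ramp_down D i * time_step D \<le> p_g \<Omega> (i, t + 1) - p_g \<Omega> (i, t) \<and>
        p_g \<Omega> (i, t + 1) - p_g \<Omega> (i, t) \<le> ramp_up D i * time_step D) \<and>
     (\<forall>t\<in>slots D. (\<Sum>i\<in>buses D. p_g \<Omega> (i, t) + p_d \<Omega> (i, t) - p_c \<Omega> (i, t))
        = (\<Sum>i\<in>buses D. demand D i t)) \<and>
     (\<forall>j\<in>branches D. \<forall>t\<in>slots D. line_lb D j \<le> flow D \<Omega> j t \<and> flow D \<Omega> j t \<le> line_ub D j)"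

definition OP_feasible :: "('n, 'l) dispatch \<Rightarrow> 'n plan \<Rightarrow> bool" where
  "OP_feasible D \<Omega> \<longleftrightarrow> RP_feasible D \<Omega> \<and>
     (\<forall>i\<in>buses D. \<forall>t\<in>slots D. p_d \<Omega> (i, t) * p_c \<Omega> (i, t) = 0)"

definition OP_optimal :: "('n, 'l) dispatch \<Rightarrow> 'n plan \<Rightarrow> bool" where
  "OP_optimal D \<Omega> \<longleftrightarrow> is_arg_min (objective D) (OP_feasible D) \<Omega>"

definition RP_optimal :: "('n, 'l) dispatch \<Rightarrow> 'n plan \<Rightarrow> bool" where
  "RP_optimal D \<Omega> \<longleftrightarrow> is_arg_min (objective D) (RP_feasible D) \<Omega>"

definition OP_value :: "('n, 'l) dispatch \<Rightarrow> real" where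
  "OP_value D = (INF \<Omega>\<in>{\<Omega>. OP_feasible D \<Omega>}. objective D \<Omega>)"

definition RP_value :: "('n, 'l) dispatch \<Rightarrow> real" where
  "RP_value D = (INF \<Omega>\<in>{\<Omega>. RP_feasible D \<Omega>}. objective D \<Omega>)"

text \<open>Multipliers of the relaxed problem. In each pair of inequality multipliers the first one belongs
  to the lower bound; \<open>\<alpha>1, \<alpha>2\<close> refer to charging and \<open>\<alpha>3, \<alpha>4\<close> to discharging, \<open>\<gamma>\<close> to the generator
  bounds, \<open>\<beta>\<close> to the stored energy, \<open>\<rho>\<close> to ramping, \<open>bal\<close> to the balance equation (\<open>\<lambda>\<close> being
  reserved syntax) and \<open>\<mu>\<close> to the line limits.\<close>

record ('n, 'l) multipliers =
  \<alpha>1 :: "'n \<Rightarrow> nat \<Rightarrow> real"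
  \<alpha>2 :: "'n \<Rightarrow> nat \<Rightarrow> real"
  \<alpha>3 :: "'n \<Rightarrow> nat \<Rightarrow> real"
  \<alpha>4 :: "'n \<Rightarrow> nat \<Rightarrow> real"
  \<gamma>1 :: "'n \<Rightarrow> nat \<Rightarrow> real"
  \<gamma>2 :: "'n \<Rightarrow> nat \<Rightarrow> real"
  \<beta>1 :: "'n \<Rightarrow> nat \<Rightarrow> real"
  \<beta>2 :: "'n \<Rightarrow> nat \<Rightarrow> real"
  \<rho>1 :: "'n \<Rightarrow> nat \<Rightarrow> real"
  \<rho>2 :: "'n \<Rightarrow> nat \<Rightarrow> real"
  bal :: "nat \<Rightarrow> real"
  \<mu>1 :: "'l \<Rightarrow> nat \<Rightarrow> real"
  \<mu>2 :: "'l \<Rightarrow> nat \<Rightarrow> real"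

definition Lagrangian :: "('n, 'l) dispatch \<Rightarrow> ('n, 'l) multipliers \<Rightarrow> 'n plan \<Rightarrow> real" where
  "Lagrangian D M \<Omega> = objective D \<Omega>
   + (\<Sum>i\<in>buses D. \<Sum>t\<in>slots D.
        \<alpha>1 M i t * (0 - p_c \<Omega> (i, t)) + \<alpha>2 M i t * (p_c \<Omega> (i, t) - charge_ub D i))
   + (\<Sum>i\<in>buses D. \<Sum>t\<in>slots D.
        \<alpha>3 M i t * (0 - p_d \<Omega> (i, t)) + \<alpha>4 M i t * (p_d \<Omega> (i, t) - discharge_ub D i))
   + (\<Sum>i\<in>buses D. \<Sum>t\<in>slots D.
        \<gamma>1 M i t * (gen_lb D i - p_g \<Omega> (i, t)) + \<gamma>2 M i t * (p_g \<Omega> (i, t) - gen_ub D i))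
   + (\<Sum>i\<in>buses D. \<Sum>t\<in>slots D.
        \<beta>1 M i t * (energy_lb D i - energy D \<Omega> i t) + \<beta>2 M i t * (energy D \<Omega> i t - energy_ub D i))
   + (\<Sum>i\<in>buses D. \<Sum>t\<in>{1..<horizon D}.
        \<rho>1 M i t * (ramp_down D i * time_step D - (p_g \<Omega> (i, t + 1) - p_g \<Omega> (i, t))) +
        \<rho>2 M i t * (p_g \<Omega> (i, t + 1) - p_g \<Omega> (i, t) - ramp_up D i * time_step D))
   + (\<Sum>t\<in>slots D. bal M t *
        ((\<Sum>i\<in>buses D. demand D i t) -
         (\<Sum>i\<in>buses D. p_g \<Omega> (i, t) + p_d \<Omega> (i, t) - p_c \<Omega> (i, t))))
   + (\<Sum>j\<in>branches D. \<Sum>t\<in>slots D.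
        \<mu>1 M j t * (line_lb D j - flow D \<Omega> j t) + \<mu>2 M j t * (flow D \<Omega> j t - line_ub D j))"

definition dual_feasible :: "('n, 'l) dispatch \<Rightarrow> ('n, 'l) multipliers \<Rightarrow> bool" where
  "dual_feasible D M \<longleftrightarrow>
     (\<forall>i\<in>buses D. \<forall>t\<in>slots D.
        \<alpha>1 M i t \<ge> 0 \<and> \<alpha>2 M i t \<ge> 0 \<and> \<alpha>3 M i t \<ge> 0 \<and> \<alpha>4 M i t \<ge> 0 \<and>
        \<gamma>1 M i t \<ge> 0 \<and> \<gamma>2 M i t \<ge> 0 \<and> \<beta>1 M i t \<ge> 0 \<and> \<beta>2 M i t \<ge> 0) \<and>
     (\<forall>i\<in>buses D. \<forall>t\<in>{1..<horizon D}. \<rho>1 M i t \<ge> 0 \<and> \<rho>2 M i t \<ge> 0) \<and>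
     (\<forall>j\<in>branches D. \<forall>t\<in>slots D. \<mu>1 M j t \<ge> 0 \<and> \<mu>2 M j t \<ge> 0)"

definition complementary_slackness ::
    "('n, 'l) dispatch \<Rightarrow> 'n plan \<Rightarrow> ('n, 'l) multipliers \<Rightarrow> bool" where
  "complementary_slackness D \<Omega> M \<longleftrightarrow>
     (\<forall>i\<in>buses D. \<forall>t\<in>slots D.
        \<alpha>1 M i t * (0 - p_c \<Omega> (i, t)) = 0 \<and>
        \<alpha>2 M i t * (p_c \<Omega> (i, t) - charge_ub D i) = 0 \<and>
        \<alpha>3 M i t * (0 - p_d \<Omega> (i, t)) = 0 \<and>
        \<alpha>4 M i t * (p_d \<Omega> (i, t) - discharge_ub D i) = 0 \<and>
        \<gamma>1 M i t * (gen_lb D i - p_g \<Omega> (i, t)) = 0 \<and>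
        \<gamma>2 M i t * (p_g \<Omega> (i, t) - gen_ub D i) = 0 \<and>
        \<beta>1 M i t * (energy_lb D i - energy D \<Omega> i t) = 0 \<and>
        \<beta>2 M i t * (energy D \<Omega> i t - energy_ub D i) = 0) \<and>
     (\<forall>i\<in>buses D. \<forall>t\<in>{1..<horizon D}.
        \<rho>1 M i t * (ramp_down D i * time_step D - (p_g \<Omega> (i, t + 1) - p_g \<Omega> (i, t))) = 0 \<and>
        \<rho>2 M i t * (p_g \<Omega> (i, t + 1) - p_g \<Omega> (i, t) - ramp_up D i * time_step D) = 0) \<and>
     (\<forall>j\<in>branches D. \<forall>t\<in>slots D.
        \<mu>1 M j t * (line_lb D j - flow D \<Omega> j t) = 0 \<and>
        \<mu>2 M j t * (flow D \<Omega> j t - line_ub D j) = 0)"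

text \<open>All partial derivatives of the Lagrangian with respect to the decision variables vanish.\<close>

definition stationary :: "('n, 'l) dispatch \<Rightarrow> 'n plan \<Rightarrow> ('n, 'l) multipliers \<Rightarrow> bool" where
  "stationary D \<Omega> M \<longleftrightarrow> (\<forall>k\<in>buses D \<times> slots D.
     ((\<lambda>x. Lagrangian D M (\<Omega>\<lparr>p_c := (p_c \<Omega>)(k := x)\<rparr>)) has_real_derivative 0) (at (p_c \<Omega> k)) \<and>
     ((\<lambda>x. Lagrangian D M (\<Omega>\<lparr>p_d := (p_d \<Omega>)(k := x)\<rparr>)) has_real_derivative 0) (at (p_d \<Omega> k)) \<and>
     ((\<lambda>x. Lagrangian D M (\<Omega>\<lparr>p_g := (p_g \<Omega>)(k := x)\<rparr>)) has_real_derivative 0) (at (p_g \<Omega> k)))"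

definition RP_KKT :: "('n, 'l) dispatch \<Rightarrow> 'n plan \<Rightarrow> ('n, 'l) multipliers \<Rightarrow> bool" where
  "RP_KKT D \<Omega> M \<longleftrightarrow>
     RP_feasible D \<Omega> \<and> dual_feasible D M \<and> complementary_slackness D \<Omega> M \<and> stationary D \<Omega> M"

definition LMP :: "('n, 'l) dispatch \<Rightarrow> ('n, 'l) multipliers \<Rightarrow> 'n \<Rightarrow> nat \<Rightarrow> real" where
  "LMP D M i t = bal M t + (\<Sum>j\<in>branches D. GSF D j i * (\<mu>1 M j t - \<mu>2 M j t))"

end

theory Submission
  imports Defs
begin

text \<open>The optimal solution of the relaxed problem turns out to be complementary, so that it is
  feasible, hence optimal, for the original problem, and uniqueness identifies the two.

  Suppose that bus \<open>i\<close> both charges and discharges in slot \<open>t\<close>. By complementary slackness the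
  multipliers of the lower bounds \<open>p_c \<ge> 0\<close> and \<open>p_d \<ge> 0\<close> vanish there. Let \<open>B\<close> be the shadow price
  of energy stored in slot \<open>t\<close>, that is, the sum of the multiplier differences \<open>\<beta>2 - \<beta>1\<close> over all
  slots \<open>\<tau> \<ge> t\<close>, discounted by the self-discharge between \<open>t\<close> and \<open>\<tau>\<close> and multiplied by the step
  length. Stationarity in the two storage variables then reads
  \<open>LMP = f' - \<alpha>2 - \<eta>c B\<close> and \<open>LMP = g' + \<alpha>4 - B / \<eta>d\<close>.
  Eliminating \<open>B\<close> gives \<open>(1 - \<eta>c \<eta>d) LMP \<le> f' - \<eta>c \<eta>d g'\<close>, which the strict price inequality
  excludes. Where that inequality fails, the upper energy bound is slack from \<open>t\<close> on, so all \<open>\<beta>2\<close>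
  in \<open>B\<close> vanish and \<open>B \<le> 0\<close>; eliminating \<open>LMP\<close> instead, and using \<open>\<eta>c < 1 / \<eta>d\<close>, gives
  \<open>f' \<ge> g'\<close>, contrary to the charging price being below the discharging price
  (\<open>KKT_storage_complementary\<close>).

  Both stationarity equations come from one exact formula for the change of the Lagrangian when
  charging and discharging vary at a single bus and slot (\<open>Lagrangian_storage_update\<close>).\<close>

section \<open>The Lagrangian as a function of one storage operation\<close>

abbreviation storage_update :: "'n plan \<Rightarrow> 'n \<times> nat \<Rightarrow> real \<Rightarrow> real \<Rightarrow> 'n plan" where
  "storage_update \<Omega> k x y \<equiv> \<Omega>\<lparr>p_c := (p_c \<Omega>)(k := x), p_d := (p_d \<Omega>)(k := y)\<rparr>"

definition energy_price :: "('n, 'l) dispatch \<Rightarrow> ('n, 'l) multipliers \<Rightarrow> 'n \<Rightarrow> nat \<Rightarrow> real" where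
  "energy_price D M i t = (\<Sum>\<tau>\<in>{t..horizon D}.
     (\<beta>2 M i \<tau> - \<beta>1 M i \<tau>) * (1 - self_discharge D i) ^ (\<tau> - t) * time_step D)"

lemma storage_update_triv:
  "storage_update \<Omega> k x (p_d \<Omega> k) = \<Omega>\<lparr>p_c := (p_c \<Omega>)(k := x)\<rparr>"
  "storage_update \<Omega> k (p_c \<Omega> k) y = \<Omega>\<lparr>p_d := (p_d \<Omega>)(k := y)\<rparr>"
  by (cases \<Omega>; simp)+

lemma sum_change_at_single_point:
  fixes F G :: "'a \<Rightarrow> real"
  assumes "finite A" and "a \<in> A" and "\<And>b. b \<in> A \<Longrightarrow> b \<noteq> a \<Longrightarrow> F b = G b"
  shows "sum F A = sum G A + (F a - G a)"
proof -
  have "sum F (A - {a}) = sum G (A - {a})"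
    using assms(3) by (intro sum.cong) auto
  then show ?thesis
    using assms(1,2) by (simp add: sum.remove)
qed

lemma double_sum_change_at_single_point:
  fixes F G :: "'a \<Rightarrow> 'b \<Rightarrow> real"
  assumes "finite A" and "a \<in> A" and "finite B" and "b \<in> B"
    and "\<And>a' b'. (a', b') \<noteq> (a, b) \<Longrightarrow> F a' b' = G a' b'"
  shows "(\<Sum>a\<in>A. \<Sum>b\<in>B. F a b) = (\<Sum>a\<in>A. \<Sum>b\<in>B. G a b) + (F a b - G a b)"
proof -
  have "(\<Sum>a\<in>A. \<Sum>b\<in>B. F a b) = (\<Sum>a\<in>A. \<Sum>b\<in>B. G a b) + ((\<Sum>b\<in>B. F a b) - (\<Sum>b\<in>B. G a b))"
    using assms by (intro sum_change_at_single_point) (auto intro!: sum.cong)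
  moreover have "(\<Sum>b\<in>B. F a b) = (\<Sum>b\<in>B. G a b) + (F a b - G a b)"
    using assms by (intro sum_change_at_single_point) auto
  ultimately show ?thesis by simp
qed

lemma energy_storage_update:
  assumes "1 \<le> t"
  shows "energy D (storage_update \<Omega> (i, t) x y) i' \<tau> = energy D \<Omega> i' \<tau> +
    (if i' = i \<and> t \<le> \<tau> then (1 - self_discharge D i) ^ (\<tau> - t) *
       (charge_eff D i * (x - p_c \<Omega> (i, t)) - (y - p_d \<Omega> (i, t)) / discharge_eff D i) * time_step D
     else 0)"
proof (cases "i' = i \<and> t \<le> \<tau>")
  case True
  let ?\<Omega>' = "storage_update \<Omega> (i, t) x y"
  let ?F = "\<lambda>\<Omega> \<sigma>. (1 - self_discharge D i) ^ (\<tau> - \<sigma>) *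
        (charge_eff D i * p_c \<Omega> (i, \<sigma>) - p_d \<Omega> (i, \<sigma>) / discharge_eff D i) * time_step D"
  have "(\<Sum>\<sigma>=1..\<tau>. ?F ?\<Omega>' \<sigma>) = (\<Sum>\<sigma>=1..\<tau>. ?F \<Omega> \<sigma>) + (?F ?\<Omega>' t - ?F \<Omega> t)"
    using True assms by (intro sum_change_at_single_point) auto
  with True show ?thesis
    by (simp add: energy_def algebra_simps diff_divide_distrib)
next
  case False
  then show ?thesis
    by (auto simp: energy_def intro!: sum.cong)
qed

lemma flow_storage_update:
  assumes "finite (buses D)" and "i \<in> buses D"
  shows "flow D (storage_update \<Omega> (i, t) x y) j \<tau> = flow D \<Omega> j \<tau> +
    (if \<tau> = t then GSF D j i * ((y - p_d \<Omega> (i, t)) - (x - p_c \<Omega> (i, t))) else 0)"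
proof (cases "\<tau> = t")
  case True
  let ?\<Omega>' = "storage_update \<Omega> (i, t) x y"
  let ?F = "\<lambda>\<Omega> i. GSF D j i * (p_g \<Omega> (i, t) + p_d \<Omega> (i, t) - p_c \<Omega> (i, t) - demand D i t)"
  have "(\<Sum>i\<in>buses D. ?F ?\<Omega>' i) = (\<Sum>i\<in>buses D. ?F \<Omega> i) + (?F ?\<Omega>' i - ?F \<Omega> i)"
    using assms by (intro sum_change_at_single_point) auto
  with True show ?thesis
    by (simp add: flow_def algebra_simps)
qed (auto simp: flow_def intro!: sum.cong)

lemma injection_storage_update:
  fixes \<Omega> :: "'n plan" and t :: nat and x y :: real
  assumes "finite (buses D)" and "i \<in> buses D"
  defines "\<Omega>' \<equiv> storage_update \<Omega> (i, t) x y"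
  shows "(\<Sum>i\<in>buses D. p_g \<Omega>' (i, \<tau>) + p_d \<Omega>' (i, \<tau>) - p_c \<Omega>' (i, \<tau>)) =
    (\<Sum>i\<in>buses D. p_g \<Omega> (i, \<tau>) + p_d \<Omega> (i, \<tau>) - p_c \<Omega> (i, \<tau>)) +
    (if \<tau> = t then (y - p_d \<Omega> (i, t)) - (x - p_c \<Omega> (i, t)) else 0)"
proof (cases "\<tau> = t")
  case True
  let ?F = "\<lambda>\<Omega> i. p_g \<Omega> (i, t) + p_d \<Omega> (i, t) - p_c \<Omega> (i, t)"
  have "(\<Sum>i\<in>buses D. ?F \<Omega>' i) = (\<Sum>i\<in>buses D. ?F \<Omega> i) + (?F \<Omega>' i - ?F \<Omega> i)"
    using assms by (intro sum_change_at_single_point) auto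
  with True show ?thesis
    by (simp add: \<Omega>'_def)
qed (auto simp: \<Omega>'_def intro!: sum.cong)

text \<open>Apart from the costs \<open>g\<^sub>i\<close> and \<open>f\<^sub>i\<close>, everything in the Lagrangian is affine in the storage
  operation \<open>(x, y)\<close>. The energy constraints see it only through the net amount stored, in slot
  \<open>t\<close> and all later ones, and the balance and line constraints only through the net injection
  into the grid, whose price is the local marginal price.\<close>

lemma Lagrangian_storage_update:
  fixes \<Omega> :: "'n plan" and x y :: real
  assumes "finite (buses D)" and "i \<in> buses D" and "t \<in> slots D"
  defines "u \<equiv> x - p_c \<Omega> (i, t)" and "v \<equiv> y - p_d \<Omega> (i, t)"
  shows "Lagrangian D M (storage_update \<Omega> (i, t) x y) = Lagrangian D M \<Omega>
    + (discharge_cost D i y - discharge_cost D i (p_d \<Omega> (i, t)))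
    - (charge_benefit D i x - charge_benefit D i (p_c \<Omega> (i, t)))
    + (\<alpha>2 M i t - \<alpha>1 M i t) * u + (\<alpha>4 M i t - \<alpha>3 M i t) * v
    + energy_price D M i t * (charge_eff D i * u - v / discharge_eff D i)
    - LMP D M i t * (v - u)"
proof -
  let ?\<Omega>' = "storage_update \<Omega> (i, t) x y"
  let ?w = "charge_eff D i * u - v / discharge_eff D i"
  have finite_slots: "finite (slots D)" and t_pos: "1 \<le> t"
    using assms(3) by (auto simp: slots_def)
  note point = double_sum_change_at_single_point

  have objective: "objective D ?\<Omega>' = objective D \<Omega>
    + (discharge_cost D i y - discharge_cost D i (p_d \<Omega> (i, t)))
    - (charge_benefit D i x - charge_benefit D i (p_c \<Omega> (i, t)))"
    unfolding objective_def
    by (subst point[OF finite_slots assms(3) assms(1,2), where G = "\<lambda>t i.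
          discharge_cost D i (p_d \<Omega> (i, t)) - charge_benefit D i (p_c \<Omega> (i, t))
            + gen_cost D i (p_g \<Omega> (i, t))"]) auto

  have charge: "(\<Sum>i\<in>buses D. \<Sum>t\<in>slots D.
        \<alpha>1 M i t * (0 - p_c ?\<Omega>' (i, t)) + \<alpha>2 M i t * (p_c ?\<Omega>' (i, t) - charge_ub D i)) =
      (\<Sum>i\<in>buses D. \<Sum>t\<in>slots D.
        \<alpha>1 M i t * (0 - p_c \<Omega> (i, t)) + \<alpha>2 M i t * (p_c \<Omega> (i, t) - charge_ub D i)) +
      (\<alpha>2 M i t - \<alpha>1 M i t) * u"
    by (subst point[OF assms(1,2) finite_slots assms(3), where G = "\<lambda>i t.
          \<alpha>1 M i t * (0 - p_c \<Omega> (i, t)) + \<alpha>2 M i t * (p_c \<Omega> (i, t) - charge_ub D i)"])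
       (auto simp: u_def algebra_simps)

  have discharge: "(\<Sum>i\<in>buses D. \<Sum>t\<in>slots D.
        \<alpha>3 M i t * (0 - p_d ?\<Omega>' (i, t)) + \<alpha>4 M i t * (p_d ?\<Omega>' (i, t) - discharge_ub D i)) =
      (\<Sum>i\<in>buses D. \<Sum>t\<in>slots D.
        \<alpha>3 M i t * (0 - p_d \<Omega> (i, t)) + \<alpha>4 M i t * (p_d \<Omega> (i, t) - discharge_ub D i)) +
      (\<alpha>4 M i t - \<alpha>3 M i t) * v"
    by (subst point[OF assms(1,2) finite_slots assms(3), where G = "\<lambda>i t.
          \<alpha>3 M i t * (0 - p_d \<Omega> (i, t)) + \<alpha>4 M i t * (p_d \<Omega> (i, t) - discharge_ub D i)"])
       (auto simp: v_def algebra_simps)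

  have energy: "(\<Sum>i\<in>buses D. \<Sum>t\<in>slots D.
        \<beta>1 M i t * (energy_lb D i - energy D ?\<Omega>' i t) + \<beta>2 M i t * (energy D ?\<Omega>' i t - energy_ub D i)) =
      (\<Sum>i\<in>buses D. \<Sum>t\<in>slots D.
        \<beta>1 M i t * (energy_lb D i - energy D \<Omega> i t) + \<beta>2 M i t * (energy D \<Omega> i t - energy_ub D i)) +
      energy_price D M i t * ?w"
  proof -
    let ?E = "\<lambda>\<Omega> i. \<Sum>t\<in>slots D.
        \<beta>1 M i t * (energy_lb D i - energy D \<Omega> i t) + \<beta>2 M i t * (energy D \<Omega> i t - energy_ub D i)"
    have "?E ?\<Omega>' i - ?E \<Omega> i = (\<Sum>\<tau>\<in>slots D. if t \<le> \<tau>
        then (\<beta>2 M i \<tau> - \<beta>1 M i \<tau>) * (1 - self_discharge D i) ^ (\<tau> - t) * time_step D * ?w else 0)"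
      unfolding sum_subtractf[symmetric]
      by (intro sum.cong refl)
         (simp add: energy_storage_update[OF t_pos] u_def[symmetric] v_def[symmetric], algebra)
    also have "\<dots> = energy_price D M i t * ?w"
    proof -
      have "{t..horizon D} = {\<tau> \<in> slots D. t \<le> \<tau>}"
        using t_pos by (auto simp: slots_def)
      then show ?thesis
        using finite_slots unfolding energy_price_def sum_distrib_right
        by (simp add: sum.inter_filter)
    qed
    finally have "?E ?\<Omega>' i - ?E \<Omega> i = energy_price D M i t * ?w" .
    moreover have "(\<Sum>i\<in>buses D. ?E ?\<Omega>' i) = (\<Sum>i\<in>buses D. ?E \<Omega> i) + (?E ?\<Omega>' i - ?E \<Omega> i)"
      unfolding energy_storage_update[OF t_pos] using assms(1,2)
      by (intro sum_change_at_single_point) auto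
    ultimately show ?thesis by simp
  qed

  have balance: "(\<Sum>t\<in>slots D. bal M t * ((\<Sum>i\<in>buses D. demand D i t) -
         (\<Sum>i\<in>buses D. p_g ?\<Omega>' (i, t) + p_d ?\<Omega>' (i, t) - p_c ?\<Omega>' (i, t)))) =
      (\<Sum>t\<in>slots D. bal M t * ((\<Sum>i\<in>buses D. demand D i t) -
         (\<Sum>i\<in>buses D. p_g \<Omega> (i, t) + p_d \<Omega> (i, t) - p_c \<Omega> (i, t)))) - bal M t * (v - u)"
    (is "(\<Sum>t\<in>_. ?E' t) = (\<Sum>t\<in>_. ?E t) - _")
  proof -
    have "(\<Sum>t\<in>slots D. ?E' t) = (\<Sum>t\<in>slots D. ?E t) + (?E' t - ?E t)"
      unfolding injection_storage_update[OF assms(1,2)]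
      using finite_slots assms(3) by (intro sum_change_at_single_point) auto
    moreover have "?E' t - ?E t = - (bal M t * (v - u))"
      unfolding injection_storage_update[OF assms(1,2)]
      by (simp add: u_def v_def algebra_simps)
    ultimately show ?thesis by simp
  qed

  have line: "(\<Sum>j\<in>branches D. \<Sum>t\<in>slots D.
        \<mu>1 M j t * (line_lb D j - flow D ?\<Omega>' j t) + \<mu>2 M j t * (flow D ?\<Omega>' j t - line_ub D j)) =
      (\<Sum>j\<in>branches D. \<Sum>t\<in>slots D.
        \<mu>1 M j t * (line_lb D j - flow D \<Omega> j t) + \<mu>2 M j t * (flow D \<Omega> j t - line_ub D j)) -
      (\<Sum>j\<in>branches D. GSF D j i * (\<mu>1 M j t - \<mu>2 M j t)) * (v - u)"
  proof -
    let ?E = "\<lambda>\<Omega> j t.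
        \<mu>1 M j t * (line_lb D j - flow D \<Omega> j t) + \<mu>2 M j t * (flow D \<Omega> j t - line_ub D j)"
    have "(\<Sum>t\<in>slots D. ?E ?\<Omega>' j t) =
      (\<Sum>t\<in>slots D. ?E \<Omega> j t) - GSF D j i * (\<mu>1 M j t - \<mu>2 M j t) * (v - u)" for j
    proof -
      have "(\<Sum>t\<in>slots D. ?E ?\<Omega>' j t) = (\<Sum>t\<in>slots D. ?E \<Omega> j t) + (?E ?\<Omega>' j t - ?E \<Omega> j t)"
        using finite_slots assms(3)
        by (intro sum_change_at_single_point) (auto simp: flow_storage_update[OF assms(1,2)])
      moreover have "?E ?\<Omega>' j t - ?E \<Omega> j t = - (GSF D j i * (\<mu>1 M j t - \<mu>2 M j t) * (v - u))"
        by (simp add: flow_storage_update[OF assms(1,2)] u_def v_def algebra_simps)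
      ultimately show ?thesis by simp
    qed
    then show ?thesis
      by (simp add: sum_subtractf sum_distrib_right)
  qed

  show ?thesis
    unfolding Lagrangian_def LMP_def objective charge discharge energy balance line
    by (simp add: algebra_simps)
qed

section \<open>Stationarity in the storage variables\<close>

lemma linear_fun_deriv:
  assumes "linear_fun f"
  shows "(f has_real_derivative deriv f x) (at x)"
proof -
  obtain b c where "f = (\<lambda>x. b * x + c)"
    using assms by (auto simp: linear_fun_def fun_eq_iff)
  then have "(f has_real_derivative b) (at x)"
    by (auto intro!: derivative_eq_intros)
  then show ?thesis
    using DERIV_imp_deriv by force
qed

lemma convex_quadratic_deriv:
  assumes "convex_quadratic g"
  shows "(g has_real_derivative deriv g x) (at x)"
proof -
  obtain a b c where "g = (\<lambda>x. a * x\<^sup>2 + b * x + c)"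
    using assms by (auto simp: convex_quadratic_def fun_eq_iff)
  then have "(g has_real_derivative (2 * a * x + b)) (at x)"
    by (auto intro!: derivative_eq_intros)
  then show ?thesis
    using DERIV_imp_deriv by force
qed

lemma stationary_charge:
  assumes "valid_dispatch D" and "stationary D \<Omega> M" and "i \<in> buses D" and "t \<in> slots D"
  shows "LMP D M i t = deriv (charge_benefit D i) (p_c \<Omega> (i, t))
    + \<alpha>1 M i t - \<alpha>2 M i t - charge_eff D i * energy_price D M i t"
proof -
  have fin: "finite (buses D)" and lin: "linear_fun (charge_benefit D i)"
    using assms(1,3) by (auto simp: valid_dispatch_def)
  let ?L = "\<lambda>x. Lagrangian D M (\<Omega>\<lparr>p_c := (p_c \<Omega>)((i, t) := x)\<rparr>)"
  have "?L = (\<lambda>x. Lagrangian D M \<Omega>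
      - (charge_benefit D i x - charge_benefit D i (p_c \<Omega> (i, t)))
      + (\<alpha>2 M i t - \<alpha>1 M i t + energy_price D M i t * charge_eff D i + LMP D M i t)
        * (x - p_c \<Omega> (i, t)))"
    using Lagrangian_storage_update[OF fin assms(3,4), where M = M and \<Omega> = \<Omega> and y = "p_d \<Omega> (i, t)"]
    unfolding storage_update_triv by (intro ext) (simp add: algebra_simps)
  then have "(?L has_real_derivative - deriv (charge_benefit D i) (p_c \<Omega> (i, t))
      + (\<alpha>2 M i t - \<alpha>1 M i t + energy_price D M i t * charge_eff D i + LMP D M i t))
      (at (p_c \<Omega> (i, t)))"
    by (auto intro!: derivative_eq_intros linear_fun_deriv[OF lin])
  moreover have "(?L has_real_derivative 0) (at (p_c \<Omega> (i, t)))"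
    using assms(2,3,4) by (auto simp: stationary_def)
  ultimately have "- deriv (charge_benefit D i) (p_c \<Omega> (i, t))
      + (\<alpha>2 M i t - \<alpha>1 M i t + energy_price D M i t * charge_eff D i + LMP D M i t) = 0"
    by (rule DERIV_unique)
  then show ?thesis
    by (simp add: algebra_simps)
qed

lemma stationary_discharge:
  assumes "valid_dispatch D" and "stationary D \<Omega> M" and "i \<in> buses D" and "t \<in> slots D"
  shows "LMP D M i t = deriv (discharge_cost D i) (p_d \<Omega> (i, t))
    - \<alpha>3 M i t + \<alpha>4 M i t - energy_price D M i t / discharge_eff D i"
proof -
  have fin: "finite (buses D)" and quad: "convex_quadratic (discharge_cost D i)"
    using assms(1,3) by (auto simp: valid_dispatch_def)
  let ?L = "\<lambda>y. Lagrangian D M (\<Omega>\<lparr>p_d := (p_d \<Omega>)((i, t) := y)\<rparr>)"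
  have "?L = (\<lambda>y. Lagrangian D M \<Omega>
      + (discharge_cost D i y - discharge_cost D i (p_d \<Omega> (i, t)))
      + (\<alpha>4 M i t - \<alpha>3 M i t - energy_price D M i t / discharge_eff D i - LMP D M i t)
        * (y - p_d \<Omega> (i, t)))"
    using Lagrangian_storage_update[OF fin assms(3,4), where M = M and \<Omega> = \<Omega> and x = "p_c \<Omega> (i, t)"]
    unfolding storage_update_triv by (intro ext) (simp add: algebra_simps diff_divide_distrib)
  then have "(?L has_real_derivative deriv (discharge_cost D i) (p_d \<Omega> (i, t))
      + (\<alpha>4 M i t - \<alpha>3 M i t - energy_price D M i t / discharge_eff D i - LMP D M i t))
      (at (p_d \<Omega> (i, t)))"
    by (auto intro!: derivative_eq_intros convex_quadratic_deriv[OF quad])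
  moreover have "(?L has_real_derivative 0) (at (p_d \<Omega> (i, t)))"
    using assms(2,3,4) by (auto simp: stationary_def)
  ultimately have "deriv (discharge_cost D i) (p_d \<Omega> (i, t))
      + (\<alpha>4 M i t - \<alpha>3 M i t - energy_price D M i t / discharge_eff D i - LMP D M i t) = 0"
    by (rule DERIV_unique)
  then show ?thesis
    by (simp add: algebra_simps)
qed

section \<open>Complementarity of the relaxed solution\<close>

text \<open>A slack upper energy bound leaves only the lower bounds to be binding, and these reward
  withdrawing less: additional stored energy then has a nonnegative value, which in the sign
  convention of \<^const>\<open>energy_price\<close> means a nonpositive price.\<close>

lemma energy_price_nonpos:
  assumes "valid_dispatch D" and "RP_KKT D \<Omega> M" and "i \<in> buses D" and "t \<in> slots D"
    and "\<forall>\<tau>\<in>slots D. \<tau> \<ge> t \<longrightarrow> energy D \<Omega> i \<tau> < energy_ub D i"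
  shows "energy_price D M i t \<le> 0"
  unfolding energy_price_def
proof (rule sum_nonpos)
  fix \<tau> assume "\<tau> \<in> {t..horizon D}"
  then have \<tau>: "\<tau> \<in> slots D" "t \<le> \<tau>"
    using assms(4) by (auto simp: slots_def)
  have "\<beta>2 M i \<tau> * (energy D \<Omega> i \<tau> - energy_ub D i) = 0" and "0 \<le> \<beta>1 M i \<tau>"
    using assms(2,3) \<tau>(1) by (auto simp: RP_KKT_def complementary_slackness_def dual_feasible_def)
  moreover have "energy D \<Omega> i \<tau> < energy_ub D i"
    using assms(5) \<tau> by blast
  ultimately have "\<beta>2 M i \<tau> - \<beta>1 M i \<tau> \<le> 0" by simp
  moreover have "0 \<le> (1 - self_discharge D i) ^ (\<tau> - t) * time_step D"
    using assms(1,3) by (auto simp: valid_dispatch_def less_imp_le)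
  ultimately show "(\<beta>2 M i \<tau> - \<beta>1 M i \<tau>) * (1 - self_discharge D i) ^ (\<tau> - t) * time_step D \<le> 0"
    by (simp add: mult.assoc mult_nonpos_nonneg)
qed

text \<open>If both operations were positive, both could be reduced, and each alternative of the price
  hypothesis names a direction in which this pays. Reducing them with the stored energy kept fixed,
  one unit of charging against \<open>\<eta>c \<eta>d\<close> units of discharging, saves
  \<open>(1 - \<eta>c \<eta>d) LMP - f' + \<eta>c \<eta>d g'\<close>, which is positive under the first alternative. Reducing
  them equally, with the net injection kept fixed, saves \<open>g' - f'\<close> and adds to the stored energy,
  which costs nothing under the second alternative.\<close>

lemma KKT_storage_complementary:
  assumes valid: "valid_dispatch D" and KKT: "RP_KKT D \<Omega> M"
    and i: "i \<in> buses D" and t: "t \<in> slots D"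
    and cheaper: "deriv (charge_benefit D i) (p_c \<Omega> (i, t)) < deriv (discharge_cost D i) (p_d \<Omega> (i, t))"
    and price: "LMP D M i t >
        (deriv (charge_benefit D i) (p_c \<Omega> (i, t)) -
          charge_eff D i * discharge_eff D i * deriv (discharge_cost D i) (p_d \<Omega> (i, t)))
        / (1 - charge_eff D i * discharge_eff D i)
      \<or> (\<forall>\<tau>\<in>slots D. \<tau> \<ge> t \<longrightarrow> energy D \<Omega> i \<tau> < energy_ub D i)"
  shows "p_d \<Omega> (i, t) * p_c \<Omega> (i, t) = 0"
proof (rule ccontr)
  assume nonzero: "p_d \<Omega> (i, t) * p_c \<Omega> (i, t) \<noteq> 0"
  define \<eta>c \<eta>d where "\<eta>c = charge_eff D i" and "\<eta>d = discharge_eff D i"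
  define f' g' where "f' = deriv (charge_benefit D i) (p_c \<Omega> (i, t))"
    and "g' = deriv (discharge_cost D i) (p_d \<Omega> (i, t))"
  define B where "B = energy_price D M i t"
  have \<eta>: "0 < \<eta>c" "0 < \<eta>d" "\<eta>c * \<eta>d < 1"
    using valid i by (auto simp: valid_dispatch_def \<eta>c_def \<eta>d_def)
  have \<alpha>_zero: "\<alpha>1 M i t = 0" "\<alpha>3 M i t = 0"
    using KKT i t nonzero by (auto simp: RP_KKT_def complementary_slackness_def)
  have \<alpha>_nonneg: "0 \<le> \<alpha>2 M i t" "0 \<le> \<alpha>4 M i t"
    using KKT i t by (auto simp: RP_KKT_def dual_feasible_def)
  have stat: "stationary D \<Omega> M"
    using KKT by (simp add: RP_KKT_def)
  have charge: "LMP D M i t = f' - \<alpha>2 M i t - \<eta>c * B"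
    using stationary_charge[OF valid stat i t] \<alpha>_zero by (simp add: f'_def \<eta>c_def B_def)
  have discharge: "LMP D M i t = g' + \<alpha>4 M i t - B / \<eta>d"
    using stationary_discharge[OF valid stat i t] \<alpha>_zero by (simp add: g'_def \<eta>d_def B_def)
  from price show False
  proof
    assume "LMP D M i t > (deriv (charge_benefit D i) (p_c \<Omega> (i, t)) -
          charge_eff D i * discharge_eff D i * deriv (discharge_cost D i) (p_d \<Omega> (i, t)))
        / (1 - charge_eff D i * discharge_eff D i)"
    then have "f' - \<eta>c * \<eta>d * g' < LMP D M i t * (1 - \<eta>c * \<eta>d)"
      using \<eta>(3) by (simp add: f'_def g'_def \<eta>c_def \<eta>d_def pos_divide_less_eq)
    moreover have "\<eta>c * \<eta>d * LMP D M i t = \<eta>c * \<eta>d * g' + \<eta>c * \<eta>d * \<alpha>4 M i t - \<eta>c * B"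
      unfolding discharge using \<eta>(2) by (simp add: algebra_simps)
    ultimately have "\<alpha>2 M i t + \<eta>c * \<eta>d * \<alpha>4 M i t < 0"
      using charge by (simp add: algebra_simps)
    moreover have "0 \<le> \<eta>c * \<eta>d * \<alpha>4 M i t"
      using \<eta>(1,2) \<alpha>_nonneg(2) by simp
    ultimately show False
      using \<alpha>_nonneg(1) by linarith
  next
    assume "\<forall>\<tau>\<in>slots D. \<tau> \<ge> t \<longrightarrow> energy D \<Omega> i \<tau> < energy_ub D i"
    then have "B \<le> 0"
      unfolding B_def by (rule energy_price_nonpos[OF valid KKT i t])
    moreover have "\<eta>c < 1 / \<eta>d"
      using \<eta> by (simp add: pos_less_divide_eq)
    ultimately have "0 \<le> B * (\<eta>c - 1 / \<eta>d)"
      by (simp add: mult_nonpos_nonpos)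
    then have "g' \<le> f'"
      using charge discharge \<alpha>_nonneg by (simp add: algebra_simps)
    with cheaper show False
      by (simp add: f'_def g'_def)
  qed
qed

section \<open>Exactness of the relaxation\<close>

lemma INF_eq_at_arg_min:
  fixes f :: "'a \<Rightarrow> real"
  assumes "is_arg_min f P x"
  shows "(INF y\<in>{y. P y}. f y) = f x"
  using assms by (intro cInf_eq_minimum) (auto simp: is_arg_min_linorder)

theorem lemma2:
  fixes D :: "('n, 'l) dispatch" and \<Omega>0 \<Omega>1 :: "'n plan" and M :: "('n, 'l) multipliers"
  assumes "valid_dispatch D"
    and "OP_optimal D \<Omega>0" and "\<And>\<Omega>. OP_optimal D \<Omega> \<Longrightarrow> \<Omega> = \<Omega>0"
    and "\<And>i x y. \<lbrakk>i \<in> buses D; x \<in> {0..charge_ub D i}; y \<in> {0..discharge_ub D i}\<rbrakk> \<Longrightarrow>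
           deriv (charge_benefit D i) x < deriv (discharge_cost D i) y"
    and "RP_optimal D \<Omega>1"
    and "RP_KKT D \<Omega>1 M"
    and "\<And>i t. \<lbrakk>i \<in> buses D; t \<in> slots D;
           \<not> LMP D M i t >
             (deriv (charge_benefit D i) (p_c \<Omega>1 (i, t)) -
               charge_eff D i * discharge_eff D i * deriv (discharge_cost D i) (p_d \<Omega>1 (i, t)))
             / (1 - charge_eff D i * discharge_eff D i)\<rbrakk> \<Longrightarrow>
           \<forall>\<tau>\<in>slots D. \<tau> \<ge> t \<longrightarrow> energy D \<Omega>1 i \<tau> < energy_ub D i"
  shows "RP_value D = OP_value D \<and> \<Omega>1 = \<Omega>0"
proof -
  have feasible: "RP_feasible D \<Omega>1"
    using assms(6) by (simp add: RP_KKT_def)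
  have "p_d \<Omega>1 (i, t) * p_c \<Omega>1 (i, t) = 0" if "i \<in> buses D" "t \<in> slots D" for i t
  proof (rule KKT_storage_complementary[OF assms(1,6) that])
    show "deriv (charge_benefit D i) (p_c \<Omega>1 (i, t)) < deriv (discharge_cost D i) (p_d \<Omega>1 (i, t))"
      using feasible that by (intro assms(4)) (auto simp: RP_feasible_def)
  qed (use assms(7)[OF that] in blast)
  then have "OP_feasible D \<Omega>1"
    using feasible by (simp add: OP_feasible_def)
  then have optimal: "OP_optimal D \<Omega>1"
    using assms(5) by (auto simp: OP_optimal_def RP_optimal_def is_arg_min_def OP_feasible_def)
  have "RP_value D = objective D \<Omega>1"
    using assms(5) unfolding RP_value_def RP_optimal_def by (rule INF_eq_at_arg_min)
  moreover have "OP_value D = objective D \<Omega>1"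
    using optimal unfolding OP_value_def OP_optimal_def by (rule INF_eq_at_arg_min)
  ultimately show ?thesis
    using assms(3)[OF optimal] by simp
qed

end
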